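(* For every $\varepsilon>0$, let $n/\log n\le\Delta\le n-1$, and let $k=\lceil (n-1)/\Delta\rceil$. Then there exist a tree $T\in\mathcal{T}(n,\Delta)$ and an $n$-vertex graph $G$ with $\delta(G)\ge n-n^{1-(1-2\varepsilon)/k}$ such that $G$ does not contain $T$.
   Context: $\mathcal{T}(n,\Delta)$ denotes the set of all $n$-vertex trees with maximum degree at most $\Delta$. $\delta(G)$ denotes the minimum degree of the graph $G$. A graph $G$ contains a tree $T$ if $G$ has a (not necessarily induced) subgraph isomorphic to $T$. Graphs are finite and simple, and $\log$ is the natural logarithm.
   Formalization: The claim is stated for all n at least some n₀ depending only on ε, since for small n it fails: for n=4, Δ=3, ε=0.1 the degree condition forces G to be complete, which contains every 4-vertex tree. *)

theory Defs
  imports Complex_Main "Graph_Theory.Digraph_Component" "Graph_Theory.Digraph_Isomorphism"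
begin

text \<open>
  A finite simple graph is an element of the locale \<^locale>\<open>pair_graph\<close>: a finite, loop-free,
  symmetric set of ordered pairs, so that each edge \<open>uv\<close> is represented by the two arcs \<open>(u,v)\<close> and
  \<open>(v,u)\<close>.  Hence the out-degree of a vertex is its usual degree.
\<close>

definition min_degree :: "'a pair_pre_digraph \<Rightarrow> nat" where
  "min_degree G = Min (out_degree (with_proj G) ` pverts G)"

definition max_degree :: "'a pair_pre_digraph \<Rightarrow> nat" where
  "max_degree G = Max (out_degree (with_proj G) ` pverts G)"

text \<open>
  The library's \<^const>\<open>tree\<close> is not usable here: it forbids all directed cycles, and every edge
  of a symmetric digraph gives the directed cycle \<open>(u,v),(v,u)\<close>.  The cycles of the undirected graph
  are the directed cycles of length at least 3.
\<close>

definition undirected_tree :: "'a pair_pre_digraph \<Rightarrow> bool" where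
  "undirected_tree T \<longleftrightarrow> pair_graph T \<and> Digraph_Component.connected (with_proj T) \<and>
     \<not> (\<exists>p. pre_digraph.cycle (with_proj T) p \<and> 3 \<le> length p)"

definition trees_of_bounded_degree :: "nat \<Rightarrow> nat \<Rightarrow> 'a pair_pre_digraph set" where
  "trees_of_bounded_degree n \<Delta> =
     {T. undirected_tree T \<and> card (pverts T) = n \<and> max_degree T \<le> \<Delta>}"

definition contains_copy :: "'a pair_pre_digraph \<Rightarrow> 'b pair_pre_digraph \<Rightarrow> bool" where
  "contains_copy G T \<longleftrightarrow>
     (\<exists>H. pair_graph H \<and> subgraph (with_proj H) (with_proj G) \<and>
          digraph_iso (with_proj T) (with_proj H))"

end

theory Submission
  imports Defs "HOL-Real_Asymp.Real_Asymp"
begin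

text \<open>
  The tree consists of a root, \<open>k\<close> hubs adjacent to it, and leaves distributed evenly over the hubs;
  the hubs have degree at most \<open>\<lceil>(n - 1) / k\<rceil> \<le> \<Delta>\<close> and every other vertex is adjacent to a hub.  So a
  graph misses this tree as soon as any \<open>k\<close> vertices have a common neighbour in its complement \<open>F\<close>.

  A graph \<open>F\<close> with this property and small maximum degree comes from a family of blocks covering all
  \<open>k\<close>-subsets of the vertex set, each block being the neighbourhood of \<open>k + 1\<close> vertices of its own.
  For bounded \<open>k\<close>, the blocks are the unions of \<open>k\<close> residue classes modulo \<open>t\<close> with
  \<open>t \<approx> n powr (1 / k)\<close>: the factor of order \<open>k\<^sup>2\<close> that this loses is absorbed by
  \<open>n powr (2 * \<epsilon> / k)\<close>.  For \<open>k\<close> up to \<open>ln n + 1\<close> not even a large constant factor may be lost,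
  and the blocks are chosen greedily among the sets of a fixed size.
\<close>

section \<open>Graphs on an initial segment of the natural numbers\<close>

text \<open>Symmetrizing and dropping loops turns an arbitrary relation into a
  \<open>pair_graph\<close>, so a tree can be given by its parent relation alone.\<close>

definition graph_of :: "nat \<Rightarrow> (nat \<Rightarrow> nat \<Rightarrow> bool) \<Rightarrow> nat pair_pre_digraph" where
  "graph_of n E = \<lparr>pverts = {..<n},
     parcs = {(u, v). u < n \<and> v < n \<and> u \<noteq> v \<and> (E u v \<or> E v u)}\<rparr>"

lemma pverts_graph_of [simp]: "pverts (graph_of n E) = {..<n}"
  by (simp add: graph_of_def)

lemma parcs_graph_of [simp]:
  "(u, v) \<in> parcs (graph_of n E) \<longleftrightarrow> u < n \<and> v < n \<and> u \<noteq> v \<and> (E u v \<or> E v u)"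
  by (simp add: graph_of_def)

lemma pair_graph_graph_of: "pair_graph (graph_of n E)"
proof unfold_locales
  have "parcs (graph_of n E) \<subseteq> {..<n} \<times> {..<n}"
    by auto
  then show "finite (parcs (graph_of n E))"
    by (rule finite_subset) simp
qed (auto simp: symmetric_def sym_def)

lemma out_degree_graph_of:
  assumes "u < n"
  shows "out_degree (with_proj (graph_of n E)) u = card {v. v < n \<and> u \<noteq> v \<and> (E u v \<or> E v u)}"
proof -
  have "out_arcs (with_proj (graph_of n E)) u = Pair u ` {v. v < n \<and> u \<noteq> v \<and> (E u v \<or> E v u)}"
    using assms by (auto simp: out_arcs_def)
  then show ?thesis
    by (simp add: out_degree_def card_image inj_on_def)
qed

section \<open>Trees from parent functions\<close>

lemma pawalk_verts_eq: "pcas u p v \<Longrightarrow> pawalk_verts u p = u # map snd p"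
  by (induction p arbitrary: u) auto

lemma pcas_fst_nth:
  "pcas u p v \<Longrightarrow> i < length p \<Longrightarrow> fst (p ! i) = (if i = 0 then u else snd (p ! (i - 1)))"
proof (induction p arbitrary: u i)
  case (Cons e p)
  then show ?case by (cases i) auto
qed simp

lemma pcas_snd_last: "pcas u p v \<Longrightarrow> p \<noteq> [] \<Longrightarrow> snd (p ! (length p - 1)) = v"
proof (induction p arbitrary: u)
  case (Cons e p)
  then show ?case by (cases p) auto
qed simp

text \<open>The two neighbours of the largest vertex of a cycle would both be its parent.\<close>
lemma undirected_tree_parent:
  assumes "n > 0" and par: "\<And>v. 0 < v \<Longrightarrow> par v < v"
  shows "undirected_tree (graph_of n (\<lambda>u v. 0 < v \<and> u = par v))" (is "undirected_tree ?T")
  unfolding undirected_tree_def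
proof (intro conjI notI)
  interpret T: pair_graph ?T by (rule pair_graph_graph_of)
  show "pair_graph ?T" by (rule pair_graph_graph_of)
  have root: "v \<rightarrow>\<^sup>*\<^bsub>with_proj ?T\<^esub> 0" if "v < n" for v
    using that
  proof (induction v rule: less_induct)
    case (less v)
    show ?case
    proof (cases "v = 0")
      case True
      then show ?thesis using T.reachable_refl[of 0] \<open>n > 0\<close> by simp
    next
      case False
      have "par v < v" using par False by simp
      then have "par v \<rightarrow>\<^sup>*\<^bsub>with_proj ?T\<^esub> 0" using less.IH[of "par v"] less.prems by linarith
      then show ?thesis
        using False \<open>par v < v\<close> less.prems
        by (intro T.adj_reachable_trans[of v "par v"]) simp_all
    qed
  qed
  \<comment> \<open>\<open>connected\<close> asks for strong connectedness of the symmetric closure;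
    the arcs being symmetric already, reachability is the same.\<close>
  have "strongly_connected (with_proj ?T)"
  proof
    show "verts (with_proj ?T) \<noteq> {}" using assms by auto
    fix u v assume "u \<in> verts (with_proj ?T)" "v \<in> verts (with_proj ?T)"
    then have "u < n" "v < n" by simp_all
    then show "u \<rightarrow>\<^sup>*\<^bsub>with_proj ?T\<^esub> v"
      by (intro T.reachable_trans[OF root T.symmetric_reachable'[OF root]])
  qed
  then show "Digraph_Component.connected (with_proj ?T)"
    unfolding Digraph_Component.connected_def strongly_connected_def
    by (simp add: T.reachable_mk_symmetric_eq[OF T.pair_sym_arcs])
  assume "\<exists>p. pre_digraph.cycle (with_proj ?T) p \<and> 3 \<le> length p"
  then obtain p u where len: "3 \<le> length p" and "T.awalk u p u"
    and "distinct (tl (pawalk_verts u p))"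
    by (auto simp: T.cycle_def)
  then have cas: "pcas u p u" and arcs: "set p \<subseteq> parcs ?T"
    and dist: "distinct (map snd p)"
    by (auto simp: T.awalk_def pawalk_verts_eq)
  define l where "l = length p"
  \<comment> \<open>The cycle as the sequence of its arc heads, indexed cyclically:
    \<open>(i + l - 1) mod l\<close> is the predecessor of \<open>i\<close> also for
    \<open>i = 0\<close>.\<close>
  define w where "w i = snd (p ! i)" for i
  have "p \<noteq> []" using len by auto
  have prev: "fst (p ! i) = w ((i + l - 1) mod l)" if "i < l" for i
  proof (cases "i = 0")
    case True
    then show ?thesis
      using pcas_fst_nth[OF cas, of i] pcas_snd_last[OF cas \<open>p \<noteq> []\<close>] that by (auto simp: w_def l_def)
  next
    case False
    then have "(i + l - 1) mod l = i - 1"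
      using that by (simp add: mod_if)
    then show ?thesis
      using pcas_fst_nth[OF cas, of i] False that by (simp add: w_def l_def)
  qed
  have adj: "(w ((i + l - 1) mod l), w i) \<in> parcs ?T" if "i < l" for i
    using arcs that prev[OF that] by (metis l_def nth_mem prod.collapse subsetD w_def)
  have inj: "i = j" if "w i = w j" "i < l" "j < l" for i j
    using dist that by (auto simp: distinct_conv_nth w_def l_def)
  have "l > 0" using \<open>p \<noteq> []\<close> by (simp add: l_def)
  then obtain i where i: "i < l" and max: "\<And>j. j < l \<Longrightarrow> w j \<le> w i"
  proof -
    have "Max (w ` {..<l}) \<in> w ` {..<l}" using \<open>l > 0\<close> by (intro Max_in) auto
    then obtain i where "i < l" "w i = Max (w ` {..<l})" by auto
    then show thesis using that[of i] by (simp add: Max_ge)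
  qed
  \<comment> \<open>Parents are smaller than their children, so the smaller end of an edge is the
    parent of the larger.\<close>
  have down: "a = par m" if "(a, m) \<in> parcs ?T \<or> (m, a) \<in> parcs ?T" "a \<le> m" for a m
    using that par by (auto dest: par)
  let ?a = "(i + l - 1) mod l" and ?b = "(i + 1) mod l"
  have "w ?a = par (w i)"
    using adj[OF i] max \<open>l > 0\<close> by (intro down) auto
  moreover have "(?b + l - 1) mod l = i"
  proof (cases "i + 1 = l")
    case False
    then show ?thesis using i by simp
  qed (use i in auto)
  then have "w ?b = par (w i)"
    using adj[of ?b] max \<open>l > 0\<close> by (intro down) auto
  ultimately have "?a = ?b"
    using inj \<open>l > 0\<close> by simp
  moreover have "?a = (if i = 0 then l - 1 else i - 1)"
    using i by (auto simp: mod_if)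
  moreover have "?b = (if i + 1 = l then 0 else i + 1)"
    using i by (auto simp: mod_if)
  \<comment> \<open>Predecessor and successor of an index modulo \<open>l\<close> coincide only if
    \<open>l \<le> 2\<close>.\<close>
  ultimately show False
    using len i by (auto simp: l_def split: if_splits)
qed

section \<open>The hub tree and its degrees\<close>

text \<open>The root is 0 and the hubs are 1 to \<open>k\<close>. The shift by one makes each class
  of \<open>v - 1\<close> modulo \<open>k\<close> consist of one hub and its leaves.\<close>

definition hub_parent :: "nat \<Rightarrow> nat \<Rightarrow> nat" where
  "hub_parent k v = (if v \<le> k then 0 else 1 + (v - 1) mod k)"

abbreviation hub_tree :: "nat \<Rightarrow> nat \<Rightarrow> nat pair_pre_digraph" where
  "hub_tree n k \<equiv> graph_of n (\<lambda>u v. 0 < v \<and> u = hub_parent k v)"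

lemma hub_parent_le: "k > 0 \<Longrightarrow> hub_parent k v \<le> k"
  by (auto simp: hub_parent_def Suc_le_eq)

lemma card_residue_class_le:
  fixes k :: nat
  assumes "k > 0" and "n \<le> k * d"
  shows "card {v. v < n \<and> v mod k = c} \<le> d"
proof -
  have "{v. v < n \<and> v mod k = c} \<subseteq> (\<lambda>q. k * q + c) ` {..<d}"
  proof
    fix v assume "v \<in> {v. v < n \<and> v mod k = c}"
    then have v: "v < k * d" "v = k * (v div k) + c" using assms by auto
    then have "v div k < d"
      using assms by (simp add: less_mult_imp_div_less mult.commute)
    with v show "v \<in> (\<lambda>q. k * q + c) ` {..<d}" by blast
  qed
  from card_mono[OF _ this] show ?thesis
    using card_image_le[of "{..<d}" "\<lambda>q. k * q + c"] by simp
qed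

text \<open>The root has \<open>k\<close> neighbours, whence \<open>k \<le> d\<close>; for the hubs,
  \<open>n - 1 \<le> k * d\<close> bounds the residue classes; a leaf sees only its hub.\<close>

lemma hub_tree_bounded_degree:
  assumes "0 < k" "k < n" "k \<le> d" "n - 1 \<le> k * d"
  shows "hub_tree n k \<in> trees_of_bounded_degree n d"
proof -
  have par: "hub_parent k v < v" if "0 < v" for v
    using that assms by (auto simp: hub_parent_def intro: le_less_trans[OF Suc_leI[OF mod_less_divisor]])
  have "max_degree (hub_tree n k) \<le> d"
    unfolding max_degree_def
  proof (subst Max_le_iff)
    show "\<forall>a\<in>out_degree (with_proj (hub_tree n k)) ` pverts (hub_tree n k). a \<le> d"
    proof safe
      fix u assume "u \<in> pverts (hub_tree n k)"
      then have u: "u < n" by simp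
      let ?N = "{v. v < n \<and> u \<noteq> v \<and> ((0 < v \<and> u = hub_parent k v) \<or> (0 < u \<and> v = hub_parent k u))}"
      consider "u = 0" | "0 < u" "u \<le> k" | "u > k" by linarith
      then have "card ?N \<le> d"
      proof cases
        case 1
        have "?N \<subseteq> {1..k}"
          using 1 by (auto simp: hub_parent_def split: if_splits)
        from card_mono[OF _ this] show ?thesis using assms by simp
      next
        case 2
        \<comment> \<open>The class of \<open>u - 1\<close> with the hub \<open>u\<close> itself
          exchanged for the root: the exchange costs nothing, so the bound is \<open>d\<close> and
          not \<open>d + 1\<close>.\<close>
        have "?N \<subseteq> insert 0 (Suc ` ({v. v < n - 1 \<and> v mod k = u - 1} - {u - 1}))"
        proof
          fix v assume v: "v \<in> ?N"
          show "v \<in> insert 0 (Suc ` ({v. v < n - 1 \<and> v mod k = u - 1} - {u - 1}))"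
          proof (cases v)
            case (Suc v')
            with v 2 have "v' < n - 1" "v' mod k = u - 1" "v' \<noteq> u - 1"
              by (auto simp: hub_parent_def split: if_splits)
            then show ?thesis using Suc by blast
          qed simp
        qed
        then have "card ?N \<le> card (insert 0 (Suc ` ({v. v < n - 1 \<and> v mod k = u - 1} - {u - 1})))"
          by (rule card_mono[rotated]) simp
        also have "\<dots> = Suc (card ({v. v < n - 1 \<and> v mod k = u - 1} - {u - 1}))"
          by (subst card_insert_disjoint) (auto simp: card_image)
        also have "\<dots> = card {v. v < n - 1 \<and> v mod k = u - 1}"
        proof -
          have "u - 1 \<in> {v. v < n - 1 \<and> v mod k = u - 1}" using 2 assms u by auto
          then show ?thesis
            by (intro card_Suc_Diff1) auto
        qed
        also have "\<dots> \<le> d"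
          using assms by (intro card_residue_class_le) auto
        finally show ?thesis .
      next
        case 3
        have "?N \<subseteq> {hub_parent k u}"
        proof -
          have "u \<noteq> hub_parent k v" for v
            using 3 hub_parent_le[OF assms(1), of v] by linarith
          then show ?thesis by blast
        qed
        from card_mono[OF _ this] show ?thesis using assms by simp
      qed
      then show "out_degree (with_proj (hub_tree n k)) u \<le> d"
        using u by (simp add: out_degree_graph_of)
    qed
  qed (use assms in auto)
  moreover have "undirected_tree (hub_tree n k)"
    using assms par by (intro undirected_tree_parent) auto
  ultimately show ?thesis
    by (simp add: trees_of_bounded_degree_def)
qed

section \<open>Spanning copies and complements\<close>

text \<open>With equally many vertices on both sides, an injective embedding is onto, so every
  vertex of \<open>G\<close> is the image of a tree vertex.\<close>

lemma contains_copy_spanningE: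
  assumes "contains_copy G T" "finite (pverts G)" "card (pverts G) = card (pverts T)"
  obtains f where "bij_betw f (pverts T) (pverts G)"
    "\<And>u v. (u, v) \<in> parcs T \<Longrightarrow> (f u, f v) \<in> parcs G"
proof -
  obtain H where H: "subgraph (with_proj H) (with_proj G)" "digraph_iso (with_proj T) (with_proj H)"
    using assms by (auto simp: contains_copy_def)
  then obtain h where h: "pre_digraph.digraph_isomorphism (with_proj T) h"
    and app: "with_proj H = app_iso h (with_proj T)"
    by (auto simp: digraph_iso_def)
  define f where "f = iso_verts h"
  have V: "pverts H = f ` pverts T" and A: "parcs H = iso_arcs h ` parcs T"
    and tl: "iso_tail h = fst" and hd: "iso_head h = snd"
    using arg_cong[OF app, of verts] arg_cong[OF app, of arcs]
      arg_cong[OF app, of tail] arg_cong[OF app, of head]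
    by (auto simp: f_def)
  have inj: "inj_on f (pverts T)"
    and ends: "\<And>a. a \<in> parcs T \<Longrightarrow> f (fst a) = fst (iso_arcs h a) \<and> f (snd a) = snd (iso_arcs h a)"
    using h by (auto simp: pre_digraph.digraph_isomorphism_def f_def tl hd)
  have sub: "pverts H \<subseteq> pverts G" "parcs H \<subseteq> parcs G"
    using H(1) by (auto simp: subgraph_def)
  show thesis
  proof
    have "f ` pverts T = pverts G"
      using sub(1) assms(2,3) card_image[OF inj] V by (intro card_subset_eq) auto
    with inj show "bij_betw f (pverts T) (pverts G)" by (simp add: bij_betw_def)
    fix u v assume uv: "(u, v) \<in> parcs T"
    then have "iso_arcs h (u, v) = (f u, f v)" using ends[OF uv] by (simp add: prod_eq_iff)
    then show "(f u, f v) \<in> parcs G"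
      using uv A sub(2) by (metis imageI subsetD)
  qed
qed

text \<open>In \<open>hub_tree n k\<close> the \<open>k\<close> hubs dominate all other vertices, whereas a common neighbour of
  \<open>k\<close> vertices in \<open>F\<close> is not dominated by them in the complement.\<close>
lemma complement_avoids_hub_tree:
  assumes "0 < k" "k < n"
    and common: "\<And>S. S \<subseteq> {..<n} \<Longrightarrow> card S = k \<Longrightarrow> \<exists>w<n. w \<notin> S \<and> (\<forall>v\<in>S. F v w)"
    and sym: "\<And>u v. F u v \<Longrightarrow> F v u"
  shows "\<not> contains_copy (graph_of n (\<lambda>u v. \<not> F u v)) (hub_tree n k)"
proof
  assume "contains_copy (graph_of n (\<lambda>u v. \<not> F u v)) (hub_tree n k)"
  then obtain f where bij: "bij_betw f {..<n} {..<n}"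
    and f: "\<And>u v. (u, v) \<in> parcs (hub_tree n k) \<Longrightarrow> (f u, f v) \<in> parcs (graph_of n (\<lambda>u v. \<not> F u v))"
    by (rule contains_copy_spanningE) auto
  have "{1..k} \<subseteq> {..<n}" using assms by auto
  with bij have "f ` {1..k} \<subseteq> {..<n}" "card (f ` {1..k}) = k"
    by (auto simp: bij_betw_def card_image inj_on_subset)
  then obtain w where w: "w < n" "w \<notin> f ` {1..k}" "\<And>h. h \<in> {1..k} \<Longrightarrow> F (f h) w"
    using common[of "f ` {1..k}"] by blast
  then have "w \<in> f ` {..<n}" using bij by (simp add: bij_betw_def)
  then obtain v where v: "v < n" "f v = w" by blast
  then have "v \<notin> {1..k}" using w(2) by blast
  \<comment> \<open>Every vertex that is not a hub has a hub as neighbour: the root has hub 1, a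
    leaf its parent.\<close>
  define h where "h = (if v = 0 then 1 else hub_parent k v)"
  have h: "h \<in> {1..k}"
    using \<open>v \<notin> {1..k}\<close> assms hub_parent_le[of k v] by (auto simp: h_def hub_parent_def)
  have "(v, h) \<in> parcs (hub_tree n k)"
    using v h assms \<open>v \<notin> {1..k}\<close> by (auto simp: h_def hub_parent_def)
  from f[OF this] have "\<not> F w (f h) \<or> \<not> F (f h) w" by (simp add: v(2))
  with w(3)[OF h] sym show False by blast
qed

text \<open>The \<open>k + 1\<close> vertices \<open>(k + 1) * j, \<dots>, (k + 1) * j + k\<close> are all joined in \<open>F\<close> to the block
  \<open>Bs ! j\<close>; hence a \<open>k\<close>-subset of the block misses one of them.\<close>
lemma blocks_avoid_hub_tree:
  fixes Bs :: "nat set list"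
  assumes k: "0 < k" "k < n" and len: "length Bs * (k + 1) \<le> n"
    and Bs: "\<And>B. B \<in> set Bs \<Longrightarrow> card B \<le> s \<and> finite B"
    and deg: "\<And>v. card {j. j < length Bs \<and> v \<in> Bs ! j} \<le> r"
    and cover: "\<And>S. S \<subseteq> {..<n} \<Longrightarrow> card S = k \<Longrightarrow> \<exists>B\<in>set Bs. S \<subseteq> B"
  shows "\<exists>G :: nat pair_pre_digraph. pair_graph G \<and> card (pverts G) = n \<and>
    n \<le> min_degree G + s + (k + 1) * r + 1 \<and> \<not> contains_copy G (hub_tree n k)"
proof -
  define m where "m = length Bs"
  \<comment> \<open>\<open>inc w v\<close>: the vertex \<open>w\<close> is one of the
    \<open>k + 1\<close> owners of a block that contains \<open>v\<close>.\<close>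
  define inc where "inc w v \<longleftrightarrow> w div (k + 1) < m \<and> v \<in> Bs ! (w div (k + 1))" for w v
  define F where "F u v \<longleftrightarrow> inc u v \<or> inc v u" for u v
  define G where "G = graph_of n (\<lambda>u v. \<not> F u v)"
  have common: "\<exists>w<n. w \<notin> S \<and> (\<forall>v\<in>S. F v w)" if S: "S \<subseteq> {..<n}" "card S = k" for S
  proof -
    obtain j where j: "j < m" "S \<subseteq> Bs ! j"
      using cover[OF S] by (metis in_set_conv_nth m_def)
    let ?W = "(\<lambda>i. (k + 1) * j + i) ` {..k}"
    have "card ?W = k + 1"
      by (subst card_image) auto
    moreover have "finite S" using S finite_subset by blast
    ultimately have "\<not> ?W \<subseteq> S"
      using card_mono[of S ?W] S by auto
    then obtain i where i: "i \<le> k" "(k + 1) * j + i \<notin> S" by auto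
    have "(k + 1) * j + i < (k + 1) * (j + 1)"
      using i by simp
    also have "\<dots> \<le> (k + 1) * m"
      using j by (intro mult_le_mono2) auto
    also have "\<dots> \<le> n" using len by (simp add: m_def mult.commute)
    finally have "(k + 1) * j + i < n" .
    moreover have "((k + 1) * j + i) div (k + 1) = j"
      using i by (subst div_mult_self4) auto
    then have "\<forall>v\<in>S. F v ((k + 1) * j + i)"
      using j by (auto simp: F_def inc_def)
    ultimately show ?thesis using i by blast
  qed
  have degree: "n \<le> out_degree (with_proj G) u + s + (k + 1) * r + 1" if "u < n" for u
  proof -
    let ?N = "{v. v < n \<and> u \<noteq> v \<and> (\<not> F u v \<or> \<not> F v u)}"
    \<comment> \<open>The neighbours of \<open>u\<close> in \<open>F\<close>: the block that
      \<open>u\<close> owns, if any, and the owners of the at most \<open>r\<close> blocks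
      containing \<open>u\<close>. The final 1 in the bound counts \<open>u\<close>.\<close>
    let ?A = "{v. inc u v}" and ?B = "{v. inc v u}"
    have A: "finite ?A" "card ?A \<le> s"
      using Bs[OF nth_mem, of "u div (k + 1)"]
      by (cases "u div (k + 1) < length Bs"; simp add: inc_def m_def)+
    have sub: "?B \<subseteq> (\<lambda>(j, i). (k + 1) * j + i) ` ({j. j < m \<and> u \<in> Bs ! j} \<times> {..k})"
    proof
      fix v assume "v \<in> ?B"
      then have "(v div (k + 1), v mod (k + 1)) \<in> {j. j < m \<and> u \<in> Bs ! j} \<times> {..k}"
        by (auto simp: inc_def simp flip: less_Suc_eq_le)
      moreover have "v = (\<lambda>(j, i). (k + 1) * j + i) (v div (k + 1), v mod (k + 1))"
        by (simp only: prod.case mult_div_mod_eq)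
      ultimately show "v \<in> (\<lambda>(j, i). (k + 1) * j + i) ` ({j. j < m \<and> u \<in> Bs ! j} \<times> {..k})"
        by (rule rev_image_eqI)
    qed
    have fin: "finite ({j. j < m \<and> u \<in> Bs ! j} \<times> {..k})" by simp
    have "card ?B \<le> card ({j. j < m \<and> u \<in> Bs ! j} \<times> {..k})"
      by (rule surj_card_le[OF fin sub])
    also have "\<dots> \<le> r * (k + 1)"
      using deg[of u] by (simp add: card_cartesian_product m_def del: mult_Suc_right)
    finally have B: "finite ?B" "card ?B \<le> r * (k + 1)"
      using finite_subset[OF sub] by auto
    have "n = card {..<n}" by simp
    also have "\<dots> \<le> card (?N \<union> (?A \<union> (?B \<union> {u})))"
      using A B by (intro card_mono) (auto simp: F_def)
    also have "\<dots> \<le> card ?N + (card ?A + (card ?B + card {u}))"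
      by (intro order.trans[OF card_Un_le] add_left_mono order.refl)
    finally show ?thesis
      using A B that by (simp add: G_def out_degree_graph_of algebra_simps)
  qed
  have "min_degree G \<in> out_degree (with_proj G) ` pverts G"
    unfolding min_degree_def using k by (intro Min_in) (auto simp: G_def)
  then have "n \<le> min_degree G + s + (k + 1) * r + 1"
    using degree by (auto simp: G_def)
  moreover have "\<not> contains_copy G (hub_tree n k)"
    unfolding G_def by (rule complement_avoids_hub_tree[OF k common]) (auto simp: F_def)
  ultimately show ?thesis
    using pair_graph_graph_of by (intro exI[of _ G]) (auto simp: G_def)
qed

section \<open>Covering all small sets by greedily chosen blocks\<close>

text \<open>By averaging, some \<open>B\<close> meets at least a proportion \<open>q\<close> of the
  elements not yet covered, so each choice shrinks their number by the factor
  \<open>1 - q\<close>.\<close>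

lemma greedy_cover:
  fixes R :: "'a \<Rightarrow> 'b \<Rightarrow> bool" and q :: real
  assumes fin: "finite X" "finite \<B>" "\<B> \<noteq> {}"
    and q: "0 \<le> q" "q \<le> 1" "\<And>x. x \<in> X \<Longrightarrow> q * card \<B> \<le> card {B\<in>\<B>. R x B}"
  shows "\<exists>Bs. length Bs = m \<and> set Bs \<subseteq> \<B> \<and>
    real (card {x\<in>X. \<forall>B\<in>set Bs. \<not> R x B}) \<le> (1 - q) ^ m * card X"
proof (induction m)
  case (Suc m)
  then obtain Bs where Bs: "length Bs = m" "set Bs \<subseteq> \<B>"
    "real (card {x\<in>X. \<forall>B\<in>set Bs. \<not> R x B}) \<le> (1 - q) ^ m * card X" by blast
  define U where "U = {x\<in>X. \<forall>B\<in>set Bs. \<not> R x B}"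
  have "finite U" using fin by (simp add: U_def)
  obtain B where B: "B \<in> \<B>" "q * card U \<le> card {x\<in>U. R x B}"
  proof (rule ccontr)
    assume "\<not> thesis"
    then have less: "real (card {x\<in>U. R x B}) < q * card U" if "B \<in> \<B>" for B
      using that \<open>\<And>B. B \<in> \<B> \<Longrightarrow> q * card U \<le> card {x\<in>U. R x B} \<Longrightarrow> thesis\<close> by force
    \<comment> \<open>Counting the related pairs in \<open>U\<close> and \<open>\<B>\<close> in two
      ways; \<open>\<B> \<noteq> {}\<close> makes the contradiction strict.\<close>
    have "(\<Sum>x\<in>U. q * card \<B>) \<le> (\<Sum>x\<in>U. real (card {B\<in>\<B>. R x B}))"
      using q by (intro sum_mono) (auto simp: U_def)
    also have "\<dots> = (\<Sum>B\<in>\<B>. real (card {x\<in>U. R x B}))"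
      using sum.swap_restrict[OF \<open>finite U\<close> fin(2), of "\<lambda>_ _. 1 :: real" R] by simp
    also have "\<dots> < (\<Sum>B\<in>\<B>. q * card U)"
      using fin less by (intro sum_strict_mono) auto
    finally show False by (simp add: algebra_simps)
  qed
  have "{x\<in>X. \<forall>B'\<in>set (B # Bs). \<not> R x B'} = U - {x\<in>U. R x B}"
    by (auto simp: U_def)
  then have "real (card {x\<in>X. \<forall>B'\<in>set (B # Bs). \<not> R x B'}) = real (card U) - real (card {x\<in>U. R x B})"
    using \<open>finite U\<close> by (simp add: card_Diff_subset card_mono of_nat_diff)
  also have "\<dots> \<le> (1 - q) * card U"
    using B by (simp add: algebra_simps)
  also have "\<dots> \<le> (1 - q) * ((1 - q) ^ m * card X)"
    using Bs(3) q by (intro mult_left_mono) (auto simp: U_def)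
  finally show ?case
    using Bs B by (intro exI[of _ "B # Bs"]) simp
qed simp

text \<open>For \<open>k \<le> s\<close> the right side is a falling factorial whose
  \<open>k\<close> factors are all at least \<open>s - k\<close>; otherwise the left side is
  0.\<close>

lemma diff_power_le_binomial_fact: "(s - k) ^ k \<le> (s choose k) * fact k"
proof (induction k arbitrary: s)
  case (Suc k)
  have "(s - Suc k) ^ Suc k \<le> s * (s - 1 - k) ^ k"
    by (simp add: mult_le_mono1)
  also have "\<dots> \<le> s * ((s - 1 choose k) * fact k)"
    by (intro mult_le_mono2 Suc.IH)
  also have "\<dots> = (Suc k * (s choose Suc k)) * fact k"
    by (subst binomial_absorption) simp
  finally show ?case by (simp add: algebra_simps)
qed simp

text \<open>A \<open>k\<close>-set lies in a proportion \<open>(s choose k) / (n choose k)\<close>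
  of the \<open>s\<close>-sets, which is at least \<open>q = ((s - k) / n) ^ k\<close>. After
  \<open>m\<close> greedy choices at most \<open>exp (- m * q) * n ^ k < 1\<close> of the
  \<open>k\<close>-sets are uncovered.\<close>

lemma ex_block_cover:
  assumes "k \<le> s" "s \<le> n" and m: "real n ^ k < exp (m * (real (s - k) / n) ^ k)"
  shows "\<exists>Bs :: nat set list. length Bs = m \<and> (\<forall>B\<in>set Bs. B \<subseteq> {..<n} \<and> card B = s) \<and>
    (\<forall>S. S \<subseteq> {..<n} \<longrightarrow> card S = k \<longrightarrow> (\<exists>B\<in>set Bs. S \<subseteq> B))"
proof -
  let ?X = "{S. S \<subseteq> {..<n} \<and> card S = k}" and ?Y = "{B. B \<subseteq> {..<n} \<and> card B = s}"
  let ?q = "(real (s - k) / n) ^ k"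
  have X: "finite ?X" "card ?X = n choose k" and Y: "finite ?Y" "card ?Y = n choose s"
    using n_subsets[of "{..<n}"] by auto
  have "?Y \<noteq> {}" using Y \<open>s \<le> n\<close> by (metis card.empty binomial_eq_0_iff leD)
  have "real (s - k) / n \<le> 1" using assms by (cases "n = 0") auto
  then have q: "0 \<le> ?q" "?q \<le> 1" by (auto simp: power_le_one)
  have "?q * card ?Y \<le> card {B\<in>?Y. S \<subseteq> B}" if S: "S \<in> ?X" for S
  proof -
    have "finite S" using S finite_subset by auto
    let ?Z = "{C. C \<subseteq> {..<n} - S \<and> card C = s - k}"
    have "(n - k) choose (s - k) = card ?Z"
      using S \<open>finite S\<close> by (subst n_subsets) (auto simp: card_Diff_subset)
    \<comment> \<open>The \<open>s\<close>-sets above \<open>S\<close> arise by adding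
      \<open>S\<close> to the \<open>(s - k)\<close>-subsets of its complement.\<close>
    also have "\<dots> = card ((\<lambda>C. C \<union> S) ` ?Z)"
      by (subst card_image) (auto simp: inj_on_def)
    also have "\<dots> \<le> card {B\<in>?Y. S \<subseteq> B}"
    proof (intro card_mono subsetI)
      fix B assume "B \<in> (\<lambda>C. C \<union> S) ` ?Z"
      then obtain C where C: "C \<subseteq> {..<n} - S" "card C = s - k" "B = C \<union> S" by auto
      then have "finite C" "C \<inter> S = {}" using finite_subset[of C "{..<n} - S"] by auto
      then have "card B = card C + card S"
        unfolding C(3) using \<open>finite S\<close> by (intro card_Un_disjoint)
      then show "B \<in> {B\<in>?Y. S \<subseteq> B}" using C S assms by auto
    qed simp
    finally have Z: "(n - k) choose (s - k) \<le> card {B\<in>?Y. S \<subseteq> B}" .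
    have "?q * (n choose k) * fact k \<le> ?q * real n ^ k"
      using binomial_fact_pow[of n k] q(1)
      by (metis (mono_tags, opaque_lifting) mult.assoc mult_left_mono of_nat_fact of_nat_le_iff of_nat_mult of_nat_power)
    also have "\<dots> \<le> real ((s - k) ^ k)"
      by (simp add: power_divide)
    also have "\<dots> \<le> real ((s choose k) * fact k)"
      by (intro of_nat_mono diff_power_le_binomial_fact)
    finally have "?q * (n choose k) \<le> real (s choose k)"
      by simp
    then have "(n choose k) * (?q * card ?Y) \<le> (n choose s) * (s choose k)"
      using mult_left_mono[of "?q * (n choose k)" "s choose k" "n choose s"]
      unfolding Y(2) by (simp add: mult_ac)
    also have "\<dots> = (n choose k) * ((n - k) choose (s - k))"
      using choose_mult[OF assms(1,2)] by (metis of_nat_mult)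
    finally have "?q * card ?Y \<le> (n - k) choose (s - k)"
      using assms by (simp add: mult_le_cancel_left_pos)
    then show ?thesis using Z by linarith
  qed
  from greedy_cover[of ?X ?Y ?q "\<lambda>S B. S \<subseteq> B" m, OF X(1) Y(1) \<open>?Y \<noteq> {}\<close> q this]
  obtain Bs where Bs: "length Bs = m" "set Bs \<subseteq> ?Y"
    "real (card {S\<in>?X. \<forall>B\<in>set Bs. \<not> S \<subseteq> B}) \<le> (1 - ?q) ^ m * card ?X" by blast
  note Bs(3)
  also have "(1 - ?q) ^ m * card ?X \<le> exp (- ?q) ^ m * real n ^ k"
    unfolding X(2) using exp_ge_add_one_self[of "- ?q"] q binomial_le_pow[of k n] assms
    by (intro mult_mono power_mono) (auto simp flip: of_nat_power)
  also have "\<dots> = real n ^ k / exp (m * ?q)"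
    by (simp add: exp_of_nat_mult[symmetric] exp_minus field_simps)
  also have "\<dots> < 1" using m by simp
  finally have "{S\<in>?X. \<forall>B\<in>set Bs. \<not> S \<subseteq> B} = {}"
    using X(1) by simp
  then show ?thesis
    using Bs(1,2) by (intro exI[of _ Bs]) auto
qed

section \<open>Covering by unions of residue classes\<close>

text \<open>There are \<open>k\<close> places for \<open>c\<close> and \<open>t ^ (k - 1)\<close>
  ways to fill the others. For \<open>k = 0\<close> the factor \<open>k\<close> makes the truncated
  exponent harmless.\<close>

lemma card_lists_containing_le:
  fixes t :: nat
  shows "card {xs. set xs \<subseteq> {..<t} \<and> length xs = k \<and> c \<in> set xs} \<le> k * t ^ (k - 1)"
proof (induction k)
  case (Suc k)
  let ?L = "{xs. set xs \<subseteq> {..<t} \<and> length xs = k}"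
  let ?M = "{xs. set xs \<subseteq> {..<t} \<and> length xs = k \<and> c \<in> set xs}"
  have L: "finite ?L" "card ?L = t ^ k"
    using finite_lists_length_eq[of "{..<t}" k] card_lists_length_eq[of "{..<t}" k] by auto
  have "finite ?M" by (rule finite_subset[OF _ L(1)]) auto
  have "{xs. set xs \<subseteq> {..<t} \<and> length xs = Suc k \<and> c \<in> set xs}
    \<subseteq> Cons c ` ?L \<union> (\<lambda>(x, xs). x # xs) ` ({..<t} \<times> ?M)" (is "?A \<subseteq> ?B \<union> ?C")
    by (auto simp: length_Suc_conv)
  then have "card ?A \<le> card (?B \<union> ?C)"
    using L \<open>finite ?M\<close> by (intro card_mono) auto
  also have "\<dots> \<le> card ?B + card ?C" by (rule card_Un_le)
  also have "\<dots> \<le> card ?L + card ({..<t} \<times> ?M)"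
    using L \<open>finite ?M\<close> by (intro add_mono card_image_le) auto
  also have "\<dots> \<le> t ^ k + t * (k * t ^ (k - 1))"
    using Suc by (simp add: L card_cartesian_product)
  also have "\<dots> = Suc k * t ^ (Suc k - 1)"
    by (cases k) (auto simp: algebra_simps)
  finally show ?case .
qed simp

text \<open>Blocks are indexed by lists of residues, with repetitions allowed: a
  \<open>k\<close>-set is covered by the list of its own residues, and \<open>v\<close> lies in a
  block iff \<open>v mod t\<close> occurs in its list.\<close>

lemma ex_residue_cover:
  fixes t :: nat
  assumes "t > 0"
  shows "\<exists>Bs :: nat set list. length Bs = t ^ k \<and>
    (\<forall>B\<in>set Bs. finite B \<and> card B \<le> k * (n div t + 1)) \<and>
    (\<forall>v. card {j. j < length Bs \<and> v \<in> Bs ! j} \<le> k * t ^ (k - 1)) \<and>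
    (\<forall>S. S \<subseteq> {..<n} \<longrightarrow> card S = k \<longrightarrow> (\<exists>B\<in>set Bs. S \<subseteq> B))"
proof -
  let ?L = "{xs. set xs \<subseteq> {..<t} \<and> length xs = k}"
  have L: "finite ?L" "card ?L = t ^ k"
    by (simp_all add: finite_lists_length_eq card_lists_length_eq)
  obtain ls where ls: "set ls = ?L" "distinct ls"
    using finite_distinct_list[OF L(1)] by auto
  define B where "B xs = {v. v < n \<and> v mod t \<in> set xs}" for xs
  have "card (B xs) \<le> k * (n div t + 1)" if "xs \<in> ?L" for xs
  proof -
    have "n \<le> t * (n div t + 1)"
      using dividend_less_times_div[OF assms, of n] by simp
    have "B xs = (\<Union>c\<in>set xs. {v. v < n \<and> v mod t = c})"
      by (auto simp: B_def)
    then have "card (B xs) \<le> (\<Sum>c\<in>set xs. card {v. v < n \<and> v mod t = c})"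
      by (simp add: card_UN_le)
    also have "\<dots> \<le> of_nat (card (set xs)) * (n div t + 1)"
      by (intro sum_bounded_above card_residue_class_le[OF assms \<open>n \<le> t * (n div t + 1)\<close>])
    also have "\<dots> \<le> k * (n div t + 1)"
      using that card_length[of xs] unfolding of_nat_id by (intro mult_le_mono1) auto
    finally show ?thesis .
  qed
  moreover have "card {j. j < length (map B ls) \<and> v \<in> map B ls ! j} \<le> k * t ^ (k - 1)" for v
  proof -
    \<comment> \<open>Different lists may give equal blocks, so positions are counted through the
      distinct lists.\<close>
    have "card {j. j < length (map B ls) \<and> v \<in> map B ls ! j} =
        card ((!) ls ` {j. j < length (map B ls) \<and> v \<in> map B ls ! j})"
      using ls(2) by (subst card_image) (auto simp: inj_on_def nth_eq_iff_index_eq)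
    also have "\<dots> \<le> card {xs. set xs \<subseteq> {..<t} \<and> length xs = k \<and> v mod t \<in> set xs}"
    proof (intro card_mono)
      show "finite {xs. set xs \<subseteq> {..<t} \<and> length xs = k \<and> v mod t \<in> set xs}"
        by (rule finite_subset[OF _ L(1)]) auto
      show "(!) ls ` {j. j < length (map B ls) \<and> v \<in> map B ls ! j}
          \<subseteq> {xs. set xs \<subseteq> {..<t} \<and> length xs = k \<and> v mod t \<in> set xs}"
        using ls(1) nth_mem[of _ ls] by (auto simp: B_def)
    qed
    also have "\<dots> \<le> k * t ^ (k - 1)" by (rule card_lists_containing_le)
    finally show ?thesis .
  qed
  moreover have "\<exists>B'\<in>set (map B ls). S \<subseteq> B'" if S: "S \<subseteq> {..<n}" "card S = k" for S
  proof -
    have "finite S" using S finite_subset by blast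
    then obtain vs where vs: "set vs = S" "length vs = k"
      using S(2) by (metis distinct_card finite_distinct_list)
    then have "map (\<lambda>v. v mod t) vs \<in> set ls"
      unfolding ls(1) using assms by auto
    moreover have "S \<subseteq> B (map (\<lambda>v. v mod t) vs)"
      using vs S(1) by (auto simp: B_def)
    ultimately show ?thesis by auto
  qed
  moreover have "length (map B ls) = t ^ k"
    using ls L(2) distinct_card[of ls] by simp
  ultimately show ?thesis
    by (intro exI[of _ "map B ls"]) (auto simp: ls(1) B_def)
qed

section \<open>Choice of parameters\<close>

lemma avoiding_graph_fixed_k:
  fixes k :: nat and \<epsilon> :: real
  assumes "0 < \<epsilon>" "0 < k"
  shows "\<forall>\<^sub>F n in sequentially. \<exists>G :: nat pair_pre_digraph. pair_graph G \<and> card (pverts G) = n \<and>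
    real (min_degree G) \<ge> real n - real n powr (1 - (1 - 2 * \<epsilon>) / k) \<and>
    \<not> contains_copy G (hub_tree n k)"
proof -
  define a where "a = 1 / real k"
  define \<delta> where "\<delta> = 2 * \<epsilon> * a"
  \<comment> \<open>Block size and owners each contribute about \<open>k * n / t\<close>, and
    rounding \<open>t\<close> down costs at most a factor 2, hence the 4.\<close>
  define C where "C = 4 * real k * (real k + 1) powr a"
  have a: "0 < a" "a \<le> 1" and "\<delta> > 0" using assms by (auto simp: a_def \<delta>_def)
  have "\<forall>\<^sub>F n :: nat in sequentially. (real n / (real k + 1)) powr a \<ge> 1"
    using \<open>0 < a\<close> by real_asymp
  moreover have "\<forall>\<^sub>F n :: nat in sequentially. C + k + 1 \<le> real n powr \<delta>"
    using \<open>\<delta> > 0\<close> by real_asymp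
  moreover have "\<forall>\<^sub>F n in sequentially. n > k" by (rule eventually_gt_at_top)
  ultimately show ?thesis
  proof eventually_elim
    case (elim n)
    define y where "y = (real n / (real k + 1)) powr a"
    define t where "t = nat \<lfloor>y\<rfloor>"
    have y: "y \<ge> 1" using elim by (simp add: y_def)
    then have "\<lfloor>y\<rfloor> \<ge> 1" by simp
    then have t: "t \<ge> 1" "real t \<le> y" "y \<le> 2 * real t"
      unfolding t_def by linarith+
    have "real t ^ k \<le> y ^ k"
      using t by (intro power_mono) auto
    also have "y ^ k = real n / (real k + 1)"
      using assms elim by (simp add: y_def a_def powr_powr flip: powr_realpow)
    finally have tk: "real t ^ k * (real k + 1) \<le> n"
      by (simp add: field_simps)
    then have len: "t ^ k * (k + 1) \<le> n"
      by (simp flip: of_nat_power of_nat_Suc of_nat_mult add: add.commute)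
    define s where "s = k * (n div t + 1)"
    define r where "r = k * t ^ (k - 1)"
    obtain Bs :: "nat set list" where "length Bs = t ^ k"
      "\<forall>B\<in>set Bs. finite B \<and> card B \<le> s"
      "\<forall>v. card {j. j < length Bs \<and> v \<in> Bs ! j} \<le> r"
      "\<forall>S. S \<subseteq> {..<n} \<longrightarrow> card S = k \<longrightarrow> (\<exists>B\<in>set Bs. S \<subseteq> B)"
      using ex_residue_cover[of t k n] t(1) by (auto simp: s_def r_def)
    then obtain G :: "nat pair_pre_digraph" where G: "pair_graph G" "card (pverts G) = n"
      "\<not> contains_copy G (hub_tree n k)" and deg: "n \<le> min_degree G + s + (k + 1) * r + 1"
      using blocks_avoid_hub_tree[of k n Bs s r] len assms elim by auto
    have "real s \<le> real k * (real n / real t + 1)"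
      unfolding s_def of_nat_mult using of_nat_div_le_of_nat[of n t, where 'a = real]
      by (intro mult_left_mono) auto
    \<comment> \<open>The constraint \<open>t ^ k * (k + 1) \<le> n\<close>, which leaves room for
      the owners, also bounds this degree term.\<close>
    moreover have "(real k + 1) * real r \<le> real k * (real n / real t)"
    proof -
      have "real t ^ (k - 1) = real t ^ k / real t"
        using t assms by (simp add: power_diff)
      then have "(real k + 1) * real r = real k * (real t ^ k * (real k + 1) / real t)"
        by (simp add: r_def)
      also have "\<dots> \<le> real k * (real n / real t)"
        using tk by (intro mult_left_mono divide_right_mono) auto
      finally show ?thesis .
    qed
    moreover have "real k * (real n / real t) \<le> C / 2 * real n powr (1 - a)"
    proof -
      have "real n / real t \<le> real n / (y / 2)"
        using t y by (intro divide_left_mono) auto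
      also have "\<dots> = 2 * ((real k + 1) powr a * real n powr (1 - a))"
        using elim by (simp add: y_def powr_divide powr_diff)
      finally have "real k * (real n / real t) \<le> real k * (2 * ((real k + 1) powr a * real n powr (1 - a)))"
        by (rule mult_left_mono) simp
      then show ?thesis by (simp add: C_def mult_ac)
    qed
    ultimately have "real s + (real k + 1) * real r + 1 \<le> C * real n powr (1 - a) + k + 1"
      unfolding distrib_left mult_1_right by linarith
    also have "\<dots> \<le> (C + k + 1) * real n powr (1 - a)"
      using a elim mult_left_mono[of 1 "real n powr (1 - a)" "real k + 1"]
      by (simp add: ge_one_powr_ge_zero algebra_simps)
    also have "\<dots> \<le> real n powr \<delta> * real n powr (1 - a)"
      using elim by (intro mult_right_mono) auto
    also have "\<dots> = real n powr (1 - (1 - 2 * \<epsilon>) / k)"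
      by (simp add: \<delta>_def a_def algebra_simps diff_divide_distrib flip: powr_add)
    finally have "real n - real n powr (1 - (1 - 2 * \<epsilon>) / k) \<le> min_degree G"
      using deg of_nat_mono[OF deg, where 'a = real] by (simp add: algebra_simps)
    then show ?case using G by blast
  qed
qed

text \<open>With block size about \<open>n p\<close> for \<open>p = n powr (- (1 - \<epsilon>) / k)\<close>, a \<open>k\<close>-set lies in a
  proportion \<open>n powr (\<epsilon> - 1)\<close> of the blocks, so the greedy cover has \<open>n powr (1 - \<epsilon>)\<close> blocks up to
  logarithms, which is negligible against \<open>n p \<ge> n powr (1 - \<epsilon> / 2)\<close>.\<close>
lemma avoiding_graph_large_k:
  fixes \<epsilon> :: real
  assumes "0 < \<epsilon>" "\<epsilon> \<le> 1 / 4"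
  shows "\<forall>\<^sub>F n in sequentially. \<forall>k::nat. 2 / \<epsilon> \<le> k \<and> real k \<le> ln n + 1 \<longrightarrow>
    (\<exists>G :: nat pair_pre_digraph. pair_graph G \<and> card (pverts G) = n \<and>
    real (min_degree G) \<ge> real n - real n powr (1 - (1 - 2 * \<epsilon>) / k) \<and>
    \<not> contains_copy G (hub_tree n k))"
proof -
  define \<eta> where "\<eta> = 1 - \<epsilon>"
  define \<theta> where "\<theta> = 1 - \<epsilon> / 2"
  have \<eta>: "0 < \<eta>" "\<eta> < \<theta>" "\<eta> < 1" "0 < \<theta>" using assms by (auto simp: \<eta>_def \<theta>_def)
  have "\<forall>\<^sub>F n :: nat in sequentially. ln n \<ge> 1" by real_asymp
  moreover have "\<forall>\<^sub>F n :: nat in sequentially. ln n + 1 < real n" by real_asymp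
  \<comment> \<open>This leaves room for \<open>k + 1\<close> owners per block; the next bound makes
    owners and rounding small against \<open>n * p\<close>.\<close>
  moreover have "\<forall>\<^sub>F n :: nat in sequentially.
      (real n powr \<eta> * ((ln n + 1) * ln n) + 1) * (ln n + 2) \<le> n"
    using \<eta> by real_asymp
  moreover have "\<forall>\<^sub>F n :: nat in sequentially.
      2 + (ln n + 1) + (ln n + 2) * (real n powr \<eta> * ((ln n + 1) * ln n) + 1) \<le> \<epsilon> / 2 * real n powr \<theta>"
    using \<eta> \<open>\<epsilon> > 0\<close> by real_asymp
  ultimately show ?thesis
  proof eventually_elim
    case (elim n)
    show ?case
    proof (intro allI impI)
      fix k :: nat
      assume k: "2 / \<epsilon> \<le> k \<and> real k \<le> ln n + 1"
      define L where "L = ln (real n)"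
      define p where "p = real n powr (- (1 - \<epsilon>) / k)"
      \<comment> \<open>One more than the floor, so that \<open>m * p ^ k\<close> strictly exceeds
        \<open>k * L\<close>, the logarithm of \<open>n ^ k\<close>.\<close>
      define m where "m = nat \<lfloor>real n powr \<eta> * (k * L)\<rfloor> + 1"
      \<comment> \<open>The summand \<open>k\<close> offsets the loss in \<open>s - k\<close>,
        giving \<open>n * p \<le> s - k\<close>.\<close>
      define s where "s = nat \<lceil>real n * p\<rceil> + k"
      define x where "x = real n powr (1 - (1 - 2 * \<epsilon>) / k)"
      have L: "L \<ge> 1" "real k \<le> L + 1" "L + 1 < n" using elim k by (auto simp: L_def)
      have "real k > 0" using k assms by (meson divide_pos_pos less_le_trans zero_less_numeral)
      then have "k > 0" "k < n" using L by auto
      then have "n > 0" by simp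
      have p: "0 < p" using \<open>n > 0\<close> by (simp add: p_def)
      have m: "real n powr \<eta> * (k * L) < m" "real m \<le> real n powr \<eta> * ((L + 1) * L) + 1"
      proof -
        have "0 \<le> real n powr \<eta> * (k * L)" using L by simp
        moreover have "real n powr \<eta> * (k * L) \<le> real n powr \<eta> * ((L + 1) * L)"
          using L by (intro mult_left_mono mult_right_mono) auto
        ultimately show "real n powr \<eta> * (k * L) < m" "real m \<le> real n powr \<eta> * ((L + 1) * L) + 1"
          unfolding m_def by linarith+
      qed
      have s: "real n * p \<le> real (s - k)" "real s \<le> real n * p + 1 + k"
      proof -
        have "0 \<le> real n * p" using p by simp
        then show "real n * p \<le> real (s - k)" "real s \<le> real n * p + 1 + k"
          unfolding s_def by linarith+
      qed
      have "real m * (real k + 1) \<le> (real n powr \<eta> * ((L + 1) * L) + 1) * (L + 2)"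
        using m(2) L by (intro mult_mono) auto
      also have "\<dots> \<le> n" using elim by (simp add: L_def)
      finally have len: "m * (k + 1) \<le> n"
        by (simp flip: of_nat_Suc of_nat_mult add: add.commute)
      have total: "real s + (real k + 1) * m + 1 \<le> x"
      proof -
        have "real s + (real k + 1) * m + 1 \<le> real n * p + (2 + (L + 1) + (L + 2) * (real n powr \<eta> * ((L + 1) * L) + 1))"
          using s(2) L mult_mono[of "real k + 1" "L + 2" m "real n powr \<eta> * ((L + 1) * L) + 1"] m(2)
          by simp
        also have "\<dots> \<le> real n * p + \<epsilon> / 2 * real n powr \<theta>"
          using elim by (simp add: L_def)
        also have "\<dots> \<le> real n * p + \<epsilon> / 2 * (real n * p)"
        proof -
          have "1 / real k \<le> \<epsilon> / 2"
            using k assms \<open>k > 0\<close> by (simp add: field_simps)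
          moreover have "(1 - \<epsilon>) / real k \<le> 1 / real k"
            using assms by (simp add: divide_right_mono)
          ultimately have "\<theta> \<le> 1 + - (1 - \<epsilon>) / k"
            unfolding \<theta>_def minus_divide_left[symmetric] by linarith
          then have "real n powr \<theta> \<le> real n powr (1 + - (1 - \<epsilon>) / k)"
            using \<open>n > 0\<close> by (intro powr_mono) auto
          also have "\<dots> = real n * p"
            using \<open>n > 0\<close> by (simp only: powr_add p_def powr_one of_nat_0_le_iff)
          finally show ?thesis using assms by simp
        qed
        also have "\<dots> = real n * p * (1 + \<epsilon> / 2)" by (simp add: algebra_simps)
        \<comment> \<open>Here \<open>k \<le> L + 1 \<le> 2 * L\<close> is essential:
          \<open>n powr (\<epsilon> / k)\<close> may be bounded, but it is at least
          \<open>1 + \<epsilon> / 2\<close>.\<close>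
        also have "\<dots> \<le> real n * p * real n powr (\<epsilon> / k)"
        proof (intro mult_left_mono)
          have "k \<le> 2 * L" using L by simp
          then have "\<epsilon> * real k \<le> \<epsilon> * (2 * L)" using assms by simp
          then have "\<epsilon> / 2 \<le> \<epsilon> / k * L" using \<open>k > 0\<close> by (simp add: field_simps)
          then have "1 + \<epsilon> / 2 \<le> exp (\<epsilon> / k * L)"
            using exp_ge_add_one_self[of "\<epsilon> / k * L"] by linarith
          then show "1 + \<epsilon> / 2 \<le> real n powr (\<epsilon> / k)"
            using \<open>n > 0\<close> by (simp add: powr_def L_def)
        qed (use p in auto)
        also have "real n * p * real n powr (\<epsilon> / k) = real n powr (1 + (- (1 - \<epsilon>) / k + \<epsilon> / k))"
          using \<open>n > 0\<close> by (simp add: p_def powr_add mult.assoc)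
        also have "1 + (- (1 - \<epsilon>) / k + \<epsilon> / k) = 1 - (1 - 2 * \<epsilon>) / k"
          using \<open>k > 0\<close> by (simp add: field_simps)
        finally show ?thesis by (simp add: x_def)
      qed
      have "x \<le> real n powr 1"
        unfolding x_def using \<open>n > 0\<close> assms by (intro powr_mono) auto
      then have "real s \<le> n" using total \<open>n > 0\<close> by (smt (verit) mult_nonneg_nonneg of_nat_0_le_iff powr_one)
      moreover have "real n ^ k < exp (m * (real (s - k) / n) ^ k)"
      proof -
        have "real n ^ k = exp (k * L)"
          using \<open>n > 0\<close> by (simp add: L_def exp_of_nat_mult)
        also have "p ^ k = real n powr (- \<eta>)"
          using \<open>n > 0\<close> \<open>k > 0\<close> by (simp add: p_def \<eta>_def powr_powr flip: powr_realpow)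
        then have "k * L = (real n powr \<eta> * (k * L)) * p ^ k"
          using \<open>n > 0\<close> by (simp add: powr_minus field_simps)
        also have "\<dots> < m * p ^ k"
          using m(1) p by (intro mult_strict_right_mono) auto
        also have "\<dots> \<le> m * (real (s - k) / n) ^ k"
          using s(1) p \<open>n > 0\<close> by (intro mult_left_mono power_mono) (auto simp: field_simps)
        finally show ?thesis by simp
      qed
      ultimately obtain Bs :: "nat set list" where Bs: "length Bs = m"
        "\<forall>B\<in>set Bs. B \<subseteq> {..<n} \<and> card B = s"
        "\<forall>S. S \<subseteq> {..<n} \<longrightarrow> card S = k \<longrightarrow> (\<exists>B\<in>set Bs. S \<subseteq> B)"
        using ex_block_cover[of k s n m] by (auto simp: s_def)
      \<comment> \<open>The trivial count suffices: there are few blocks in all.\<close>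
      have "card {j. j < length Bs \<and> v \<in> Bs ! j} \<le> m" for v
        using card_mono[of "{..<m}" "{j. j < length Bs \<and> v \<in> Bs ! j}"] Bs(1) by auto
      moreover have "card B \<le> s \<and> finite B" if "B \<in> set Bs" for B
        using Bs(2) that finite_subset[of B "{..<n}"] by auto
      ultimately obtain G :: "nat pair_pre_digraph" where G: "pair_graph G" "card (pverts G) = n"
        "\<not> contains_copy G (hub_tree n k)" and deg: "n \<le> min_degree G + s + (k + 1) * m + 1"
        using blocks_avoid_hub_tree[of k n Bs s m] len Bs(1,3) \<open>k > 0\<close> \<open>k < n\<close> by auto
      have "real n - x \<le> min_degree G"
        using total of_nat_mono[OF deg, where 'a = real] by (simp add: algebra_simps)
      then show "\<exists>G :: nat pair_pre_digraph. pair_graph G \<and> card (pverts G) = n \<and>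
        real (min_degree G) \<ge> real n - real n powr (1 - (1 - 2 * \<epsilon>) / k) \<and>
        \<not> contains_copy G (hub_tree n k)"
        using G by (auto simp: x_def)
    qed
  qed
qed

text \<open>The threshold for fixed \<open>k\<close> depends on \<open>k\<close>, but only finitely
  many \<open>k\<close> are treated so; the larger ones share one threshold.\<close>

lemma avoiding_graph:
  fixes \<epsilon> :: real
  assumes "0 < \<epsilon>" "\<epsilon> \<le> 1 / 4"
  shows "\<forall>\<^sub>F n in sequentially. \<forall>k::nat. 0 < k \<and> real k \<le> ln n + 1 \<longrightarrow>
    (\<exists>G :: nat pair_pre_digraph. pair_graph G \<and> card (pverts G) = n \<and>
    real (min_degree G) \<ge> real n - real n powr (1 - (1 - 2 * \<epsilon>) / k) \<and>
    \<not> contains_copy G (hub_tree n k))"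
proof -
  have "\<forall>\<^sub>F n in sequentially. \<forall>k\<in>{1..nat \<lceil>2 / \<epsilon>\<rceil>}.
    \<exists>G :: nat pair_pre_digraph. pair_graph G \<and> card (pverts G) = n \<and>
    real (min_degree G) \<ge> real n - real n powr (1 - (1 - 2 * \<epsilon>) / k) \<and>
    \<not> contains_copy G (hub_tree n k)"
    using avoiding_graph_fixed_k[OF assms(1)] by (intro eventually_ball_finite) auto
  with avoiding_graph_large_k[OF assms] show ?thesis
  proof eventually_elim
    case (elim n)
    show ?case
    proof (intro allI impI)
      fix k :: nat assume k: "0 < k \<and> real k \<le> ln n + 1"
      show "\<exists>G :: nat pair_pre_digraph. pair_graph G \<and> card (pverts G) = n \<and>
        real (min_degree G) \<ge> real n - real n powr (1 - (1 - 2 * \<epsilon>) / k) \<and>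
        \<not> contains_copy G (hub_tree n k)"
      proof (cases "k \<le> nat \<lceil>2 / \<epsilon>\<rceil>")
        case True
        then show ?thesis using elim(2) k by (simp add: Suc_le_eq)
      next
        case False
        then have "2 / \<epsilon> \<le> k" by linarith
        then show ?thesis using elim(1) k by blast
      qed
    qed
  qed
qed

theorem corollary1p4:
  fixes \<epsilon> :: real
  assumes "\<epsilon> > 0"
  shows "\<exists>n\<^sub>0 :: nat. \<forall>n \<ge> n\<^sub>0. \<forall>\<Delta> :: nat.
    real n / ln (real n) \<le> real \<Delta> \<and> real \<Delta> \<le> real n - 1 \<longrightarrow>
    (let k = \<lceil>(real n - 1) / real \<Delta>\<rceil> in
      \<exists>T \<in> (trees_of_bounded_degree n \<Delta> :: nat pair_pre_digraph set).
      \<exists>G :: nat pair_pre_digraph.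
        pair_graph G \<and> card (pverts G) = n \<and>
        real (min_degree G) \<ge> real n - real n powr (1 - (1 - 2 * \<epsilon>) / real_of_int k) \<and>
        \<not> contains_copy G T)"
proof -
  \<comment> \<open>A smaller \<open>\<epsilon>\<close> gives a stronger degree bound, so it may be
    capped.\<close>
  define \<epsilon>' where "\<epsilon>' = min \<epsilon> (1 / 4)"
  have \<epsilon>': "0 < \<epsilon>'" "\<epsilon>' \<le> 1 / 4" "\<epsilon>' \<le> \<epsilon>" using assms by (auto simp: \<epsilon>'_def)
  have "\<forall>\<^sub>F n :: nat in sequentially. ln n \<ge> 1" by real_asymp
  moreover have "\<forall>\<^sub>F n :: nat in sequentially. ln n + 1 < real n" by real_asymp
  \<comment> \<open>Together with \<open>k \<le> ln n + 1\<close> this yields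
    \<open>k \<le> \<Delta>\<close>, needed for the degree of the root.\<close>
  moreover have "\<forall>\<^sub>F n :: nat in sequentially. ln n + 1 \<le> real n / ln n" by real_asymp
  ultimately have "\<forall>\<^sub>F n in sequentially. \<forall>\<Delta> :: nat.
    real n / ln (real n) \<le> real \<Delta> \<and> real \<Delta> \<le> real n - 1 \<longrightarrow>
    (let k = \<lceil>(real n - 1) / real \<Delta>\<rceil> in
      \<exists>T \<in> (trees_of_bounded_degree n \<Delta> :: nat pair_pre_digraph set).
      \<exists>G :: nat pair_pre_digraph.
        pair_graph G \<and> card (pverts G) = n \<and>
        real (min_degree G) \<ge> real n - real n powr (1 - (1 - 2 * \<epsilon>) / real_of_int k) \<and>
        \<not> contains_copy G T)"
    using avoiding_graph[OF \<epsilon>'(1,2)]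
  proof eventually_elim
    case (elim n)
    show ?case
    proof (intro allI impI)
      fix \<Delta> :: nat
      assume \<Delta>: "real n / ln (real n) \<le> real \<Delta> \<and> real \<Delta> \<le> real n - 1"
      define k where "k = nat \<lceil>(real n - 1) / real \<Delta>\<rceil>"
      have "real \<Delta> \<ge> ln n + 1" using \<Delta> elim by linarith
      then have "real \<Delta> > 0" "real n > 1" using elim by linarith+
      then have "(real n - 1) / real \<Delta> > 0" by simp
      then have k: "int k = \<lceil>(real n - 1) / real \<Delta>\<rceil>" "0 < k"
        by (auto simp: k_def)
      have "(real n - 1) / real \<Delta> \<le> real n / real \<Delta>"
        by (simp add: divide_right_mono)
      also have "\<dots> \<le> ln n"
        using \<Delta> elim \<open>real \<Delta> > 0\<close> by (simp add: field_simps)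
      finally have k_le: "real k \<le> ln n + 1"
        using k(1) by linarith
      have "real n - 1 \<le> real k * real \<Delta>"
        using k(1) le_of_int_ceiling[of "(real n - 1) / real \<Delta>"] \<open>real \<Delta> > 0\<close>
        by (metis of_int_of_nat_eq pos_divide_le_eq)
      then have "real n \<le> real (k * \<Delta> + 1)" by simp
      then have "n - 1 \<le> k * \<Delta>" unfolding of_nat_le_iff by simp
      moreover have "k < n" "k \<le> \<Delta>"
        using k_le elim \<open>real \<Delta> \<ge> ln n + 1\<close> by linarith+
      ultimately have T: "hub_tree n k \<in> trees_of_bounded_degree n \<Delta>"
        using \<open>0 < k\<close> by (intro hub_tree_bounded_degree)
      obtain G :: "nat pair_pre_digraph" where G: "pair_graph G" "card (pverts G) = n"
        "real n - real n powr (1 - (1 - 2 * \<epsilon>') / k) \<le> min_degree G"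
        "\<not> contains_copy G (hub_tree n k)"
        using elim(4) \<open>0 < k\<close> k_le by blast
      have "real n powr (1 - (1 - 2 * \<epsilon>') / k) \<le> real n powr (1 - (1 - 2 * \<epsilon>) / k)"
        using \<open>real n > 1\<close> \<epsilon>' by (intro powr_mono diff_left_mono divide_right_mono) auto
      with G(3) have "real n - real n powr (1 - (1 - 2 * \<epsilon>) / k) \<le> min_degree G"
        by linarith
      then show "let k = \<lceil>(real n - 1) / real \<Delta>\<rceil> in
        \<exists>T \<in> (trees_of_bounded_degree n \<Delta> :: nat pair_pre_digraph set).
        \<exists>G :: nat pair_pre_digraph.
          pair_graph G \<and> card (pverts G) = n \<and>
          real (min_degree G) \<ge> real n - real n powr (1 - (1 - 2 * \<epsilon>) / real_of_int k) \<and>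
          \<not> contains_copy G T"
        unfolding Let_def k(1)[symmetric] of_int_of_nat_eq using T G(1,2,4) by blast
    qed
  qed
  then show ?thesis by (simp add: eventually_sequentially)
qed

end
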